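(* Let $Y$ be an object of $\mathcal{S}$ which is total and inhabited. Then in the internal logic of $\mathcal{S}$: $\forall\,\kappa:\mathbb{K}.\ \forall\,\phi:\Omega^{Y}.\ \triangleright^{\kappa}\big(\exists\,y:Y.\ \phi(y)\big)\Rightarrow\exists\,y:Y.\ \triangleright^{\kappa}\phi(y)$.
   Context: Let $\mathbb{F}^+$ be the category whose objects are $\bullet^n$ for $n>0$ (free category with strictly associative binary products on one object); a morphism $\bullet^n\to\bullet^m$ is equivalently a function $\{0,\dots,m-1\}\to\{0,\dots,n-1\}$. Let $\mathcal{N}=\mathrm{Hom}_{\mathbb{F}^+}(-,\bullet^1)$. For $U\in\mathbb{F}^+$ let $\mathrm{CLK}[U]=\omega^{\mathcal{N}(U)}$ ordered pointwise, with $\mathrm{CLK}[f](\partial_V)=(\kappa\mapsto\partial_V(f^*\kappa))$ for $f:V\to U$. The category $\mathbb{CLK}$ has objects $\mathbf{U}=(U,\partial_U)$ and morphisms $f:(V,\partial_V)\to(U,\partial_U)$ the $\mathbb{F}^+$-maps $f:V\to U$ with $\mathrm{CLK}[f](\partial_V)\le\partial_U$. $\mathcal{S}$ is the presheaf topos on $\mathbb{CLK}$, with clock object $\mathbb{K}(U,\partial_U)=\mathcal{N}(U)$ and subobject classifier $\Omega$. Write $\mathbf{U}[\kappa\mapsto n]$ for $(U,\partial_U[\kappa\mapsto n])$, and for $\kappa\in\mathcal{N}(U)$ and $n\in\omega$ write $[\kappa\mathrel{+}=n]:\mathbf{U}\to\mathbf{U}[\kappa\mapsto\partial_U(\kappa)+n]$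 for the morphism with identity underlying $\mathbb{F}^+$-map. The later modality is defined by forcing: $\mathbf{U}\Vdash\triangleright^{\kappa}\phi(\alpha)$ iff $\partial_U(\kappa)=0$, or $\partial_U(\kappa)=n+1$ and $\mathbf{U}[\kappa\mapsto n]\Vdash\phi([\kappa\mathrel{+}=1]^*\alpha)$; other connectives have standard Kripke–Joyal semantics. An object $X\in\mathcal{S}$ is total if for every such restriction map $[\kappa\mathrel{+}=n]$ the function $X([\kappa\mathrel{+}=n])$ is surjective; $X$ is inhabited if the formula $\exists\,x:X.\ \top$ is valid in the internal logic of $\mathcal{S}$. *)

theory Defs
  imports "HOL-Library.FuncSet"
begin

section \<open>The category of clock contexts\<close>

text \<open>The object $\bullet^n$ of $\mathbb{F}^+$ is the number \<open>n > 0\<close>.  Arrows \<open>n \<rightarrow> m\<close> are functions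
  in the opposite direction, so composition of arrows is reversed composition of functions.\<close>

definition F_hom :: "nat \<Rightarrow> nat \<Rightarrow> (nat \<Rightarrow> nat) set" where
  "F_hom n m = {..<m} \<rightarrow>\<^sub>E {..<n}"

definition F_id :: "nat \<Rightarrow> nat \<Rightarrow> nat" where
  "F_id n = (\<lambda>i\<in>{..<n}. i)"

text \<open>\<open>F_comp m g f\<close> is the composite of \<open>f : l \<rightarrow> n\<close> followed by \<open>g : n \<rightarrow> m\<close>.\<close>

definition F_comp :: "nat \<Rightarrow> (nat \<Rightarrow> nat) \<Rightarrow> (nat \<Rightarrow> nat) \<Rightarrow> nat \<Rightarrow> nat" where
  "F_comp m g f = compose {..<m} f g"

type_synonym clock = "nat \<Rightarrow> nat"

definition names :: "nat \<Rightarrow> clock set" where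
  "names u = F_hom u 1"

definition rename :: "(nat \<Rightarrow> nat) \<Rightarrow> clock \<Rightarrow> clock" where
  "rename f \<kappa> = F_comp 1 \<kappa> f"

definition clk :: "nat \<Rightarrow> (clock \<Rightarrow> nat) set" where
  "clk u = names u \<rightarrow>\<^sub>E UNIV"

definition clk_le :: "nat \<Rightarrow> (clock \<Rightarrow> nat) \<Rightarrow> (clock \<Rightarrow> nat) \<Rightarrow> bool" where
  "clk_le u d e \<longleftrightarrow> (\<forall>\<kappa>\<in>names u. d \<kappa> \<le> e \<kappa>)"

definition clk_map :: "nat \<Rightarrow> (nat \<Rightarrow> nat) \<Rightarrow> (clock \<Rightarrow> nat) \<Rightarrow> clock \<Rightarrow> nat" where
  "clk_map u f d = (\<lambda>\<kappa>\<in>names u. d (rename f \<kappa>))"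

record clk_obj =
  ctx :: nat
  time :: "clock \<Rightarrow> nat"

record clk_arr =
  src :: clk_obj
  trg :: clk_obj
  und :: "nat \<Rightarrow> nat"

definition Obj :: "clk_obj set" where
  "Obj = {U. 0 < ctx U \<and> time U \<in> clk (ctx U)}"

definition Arr :: "clk_arr set" where
  "Arr = {f. src f \<in> Obj \<and> trg f \<in> Obj \<and> und f \<in> F_hom (ctx (src f)) (ctx (trg f)) \<and>
     clk_le (ctx (trg f)) (clk_map (ctx (trg f)) (und f) (time (src f))) (time (trg f))}"

definition Into :: "clk_obj \<Rightarrow> clk_arr set" where
  "Into U = {f \<in> Arr. trg f = U}"

definition Ident :: "clk_obj \<Rightarrow> clk_arr" where
  "Ident U = \<lparr>src = U, trg = U, und = F_id (ctx U)\<rparr>"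

definition Comp :: "clk_arr \<Rightarrow> clk_arr \<Rightarrow> clk_arr" where
  "Comp g f = \<lparr>src = src f, trg = trg g, und = F_comp (ctx (trg g)) (und g) (und f)\<rparr>"

definition set_time :: "clk_obj \<Rightarrow> clock \<Rightarrow> nat \<Rightarrow> clk_obj" where
  "set_time U \<kappa> n = U\<lparr>time := (time U)(\<kappa> := n)\<rparr>"

definition advance :: "clk_obj \<Rightarrow> clock \<Rightarrow> nat \<Rightarrow> clk_arr" where
  "advance U \<kappa> n =
     \<lparr>src = U, trg = set_time U \<kappa> (time U \<kappa> + n), und = F_id (ctx U)\<rparr>"


section \<open>Presheaves\<close>

record 'a presheaf =
  el :: "clk_obj \<Rightarrow> 'a set"
  res :: "clk_arr \<Rightarrow> 'a \<Rightarrow> 'a"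

definition is_presheaf :: "'a presheaf \<Rightarrow> bool" where
  "is_presheaf X \<longleftrightarrow>
     (\<forall>f\<in>Arr. \<forall>x\<in>el X (trg f). res X f x \<in> el X (src f)) \<and>
     (\<forall>U\<in>Obj. \<forall>x\<in>el X U. res X (Ident U) x = x) \<and>
     (\<forall>g\<in>Arr. \<forall>f\<in>Into (src g). \<forall>x\<in>el X (trg g). res X (Comp g f) x = res X f (res X g x))"

definition One :: "unit presheaf" where
  "One = \<lparr>el = (\<lambda>U. {()}), res = (\<lambda>f x. x)\<rparr>"

definition Product :: "'a presheaf \<Rightarrow> 'b presheaf \<Rightarrow> ('a \<times> 'b) presheaf" where
  "Product X Y = \<lparr>el = (\<lambda>U. el X U \<times> el Y U), res = (\<lambda>f (x, y). (res X f x, res Y f y))\<rparr>"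

definition Clock :: "clock presheaf" where
  "Clock = \<lparr>el = (\<lambda>U. names (ctx U)), res = (\<lambda>f. rename (und f))\<rparr>"

definition is_sieve :: "clk_obj \<Rightarrow> clk_arr set \<Rightarrow> bool" where
  "is_sieve U S \<longleftrightarrow> S \<subseteq> Into U \<and> (\<forall>f\<in>S. \<forall>g\<in>Into (src f). Comp f g \<in> S)"

definition Omega :: "clk_arr set presheaf" where
  "Omega = \<lparr>el = (\<lambda>U. {S. is_sieve U S}), res = (\<lambda>f S. {g \<in> Into (src f). Comp f g \<in> S})\<rparr>"

text \<open>The elements of the exponential \<open>Exp Y Z\<close> (that is, $Z^Y$) at \<open>U\<close> are the natural
  transformations from the product of the representable presheaf on \<open>U\<close> with \<open>Y\<close> to \<open>Z\<close>.\<close>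

definition Exp :: "'b presheaf \<Rightarrow> 'c presheaf \<Rightarrow> (clk_arr \<times> 'b \<Rightarrow> 'c) presheaf" where
  "Exp Y Z =
     \<lparr>el = (\<lambda>U. {\<theta>. \<theta> \<in> (\<Pi>\<^sub>E p \<in> (SIGMA f:Into U. el Y (src f)). el Z (src (fst p))) \<and>
              (\<forall>f\<in>Into U. \<forall>y\<in>el Y (src f). \<forall>g\<in>Into (src f).
                 \<theta> (Comp f g, res Y g y) = res Z g (\<theta> (f, y)))}),
      res = (\<lambda>h \<theta>. \<lambda>(f, y) \<in> (SIGMA f:Into (src h). el Y (src f)). \<theta> (Comp h f, y))\<rparr>"

definition ev :: "clk_obj \<Rightarrow> (clk_arr \<times> 'b \<Rightarrow> 'c) \<Rightarrow> 'b \<Rightarrow> 'c" where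
  "ev U \<theta> y = \<theta> (Ident U, y)"

definition is_total :: "'a presheaf \<Rightarrow> bool" where
  "is_total X \<longleftrightarrow> (\<forall>U\<in>Obj. \<forall>\<kappa>\<in>names (ctx U). \<forall>n.
     res X (advance U \<kappa> n) ` el X (set_time U \<kappa> (time U \<kappa> + n)) = el X U)"


section \<open>Kripke--Joyal semantics\<close>

text \<open>A term in context \<open>\<Gamma>\<close> assigns a value to each stage \<open>U\<close> and each element of \<open>\<Gamma>\<close> at \<open>U\<close>.
  A formula takes its context \<open>\<Gamma>\<close>, a stage \<open>U\<close> and \<open>\<alpha> \<in> el \<Gamma> U\<close>, and says whether \<open>U\<close> forces it
  at \<open>\<alpha>\<close>; binders extend the context on the right.\<close>

type_synonym ('g, 'a) tm = "clk_obj \<Rightarrow> 'g \<Rightarrow> 'a"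
type_synonym 'g fm = "'g presheaf \<Rightarrow> clk_obj \<Rightarrow> 'g \<Rightarrow> bool"

text \<open>De Bruijn variables: \<open>v0\<close> is the innermost one.\<close>

definition v0 :: "('g \<times> 'a, 'a) tm" where
  "v0 U \<alpha> = snd \<alpha>"

definition v1 :: "(('g \<times> 'a) \<times> 'b, 'a) tm" where
  "v1 U \<alpha> = snd (fst \<alpha>)"

definition v2 :: "((('g \<times> 'a) \<times> 'b) \<times> 'c, 'a) tm" where
  "v2 U \<alpha> = snd (fst (fst \<alpha>))"

definition Truth :: "'g fm" where
  "Truth \<Gamma> U \<alpha> \<longleftrightarrow> True"

text \<open>The atomic formula \<open>p(t)\<close> for \<open>p : \<Omega>\<^sup>Y\<close> and \<open>t : Y\<close>; truth at \<open>U\<close> is the maximal sieve.\<close>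

definition App :: "('g, clk_arr \<times> 'a \<Rightarrow> clk_arr set) tm \<Rightarrow> ('g, 'a) tm \<Rightarrow> 'g fm" where
  "App p t \<Gamma> U \<alpha> \<longleftrightarrow> ev U (p U \<alpha>) (t U \<alpha>) = Into U"

definition Imp :: "'g fm \<Rightarrow> 'g fm \<Rightarrow> 'g fm" where
  "Imp \<phi> \<psi> \<Gamma> U \<alpha> \<longleftrightarrow>
     (\<forall>f\<in>Into U. \<phi> \<Gamma> (src f) (res \<Gamma> f \<alpha>) \<longrightarrow> \<psi> \<Gamma> (src f) (res \<Gamma> f \<alpha>))"

definition Forall :: "'a presheaf \<Rightarrow> ('g \<times> 'a) fm \<Rightarrow> 'g fm" where
  "Forall X \<phi> \<Gamma> U \<alpha> \<longleftrightarrow>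
     (\<forall>f\<in>Into U. \<forall>x\<in>el X (src f). \<phi> (Product \<Gamma> X) (src f) (res \<Gamma> f \<alpha>, x))"

definition Exists :: "'a presheaf \<Rightarrow> ('g \<times> 'a) fm \<Rightarrow> 'g fm" where
  "Exists X \<phi> \<Gamma> U \<alpha> \<longleftrightarrow> (\<exists>x\<in>el X U. \<phi> (Product \<Gamma> X) U (\<alpha>, x))"

definition Later :: "('g, clock) tm \<Rightarrow> 'g fm \<Rightarrow> 'g fm" where
  "Later k \<phi> \<Gamma> U \<alpha> \<longleftrightarrow> (let \<kappa> = k U \<alpha> in
     time U \<kappa> = 0 \<or>
     (\<exists>n. time U \<kappa> = n + 1 \<and>
        \<phi> \<Gamma> (set_time U \<kappa> n) (res \<Gamma> (advance (set_time U \<kappa> n) \<kappa> 1) \<alpha>)))"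

definition valid :: "unit fm \<Rightarrow> bool" where
  "valid \<phi> \<longleftrightarrow> (\<forall>U\<in>Obj. \<phi> One U ())"

definition inhabited :: "'a presheaf \<Rightarrow> bool" where
  "inhabited X \<longleftrightarrow> valid (Exists X Truth)"


section \<open>Well-definedness\<close>

lemma F_id_hom: "F_id n \<in> F_hom n n"
  by (auto simp: F_id_def F_hom_def)

lemma F_comp_hom: "g \<in> F_hom n m \<Longrightarrow> f \<in> F_hom l n \<Longrightarrow> F_comp m g f \<in> F_hom l m"
  by (auto simp: F_comp_def F_hom_def compose_def)

lemma F_comp_id_left: "f \<in> F_hom l n \<Longrightarrow> F_comp n (F_id n) f = f"
  by (auto simp: F_comp_def F_hom_def F_id_def compose_def PiE_def extensional_def fun_eq_iff)

lemma F_comp_id_right: "f \<in> F_hom l n \<Longrightarrow> F_comp n f (F_id l) = f"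
  by (rule ext) (auto simp: F_comp_def F_hom_def F_id_def compose_def PiE_def extensional_def)

lemma F_comp_assoc:
  "h \<in> F_hom n m \<Longrightarrow> F_comp m h (F_comp n g f) = F_comp m (F_comp m h g) f"
  by (rule ext) (auto simp: F_comp_def F_hom_def compose_def PiE_def)

lemma rename_names: "f \<in> F_hom v u \<Longrightarrow> \<kappa> \<in> names u \<Longrightarrow> rename f \<kappa> \<in> names v"
  by (simp add: rename_def names_def F_comp_hom)

lemma rename_id: "\<kappa> \<in> names u \<Longrightarrow> rename (F_id u) \<kappa> = \<kappa>"
  by (simp add: rename_def names_def F_comp_id_right)

lemma rename_comp:
  "\<kappa> \<in> names u \<Longrightarrow> rename (F_comp u g f) \<kappa> = rename f (rename g \<kappa>)"
  by (simp add: rename_def names_def F_comp_assoc)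

lemma Arr_iff: "f \<in> Arr \<longleftrightarrow> src f \<in> Obj \<and> trg f \<in> Obj \<and> und f \<in> F_hom (ctx (src f)) (ctx (trg f))
   \<and> (\<forall>\<kappa>\<in>names (ctx (trg f)). time (src f) (rename (und f) \<kappa>) \<le> time (trg f) \<kappa>)"
  by (simp add: Arr_def clk_le_def clk_map_def)

lemma Ident_Into: "U \<in> Obj \<Longrightarrow> Ident U \<in> Into U"
  by (simp add: Into_def Arr_iff Ident_def F_id_hom rename_id)

lemma Comp_Into:
  assumes "g \<in> Into U" "f \<in> Into (src g)" shows "Comp g f \<in> Into U"
proof -
  have "time (src f) (rename (und f) (rename (und g) \<kappa>)) \<le> time U \<kappa>" if "\<kappa> \<in> names (ctx U)" for \<kappa>
    using assms that rename_names[of "und g" "ctx (src g)" "ctx U" \<kappa>]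
    by (fastforce simp: Into_def Arr_iff intro: order_trans)
  then show ?thesis using assms
    by (auto simp: Into_def Arr_iff Comp_def rename_comp intro: F_comp_hom)
qed

lemma Comp_Ident_left: "f \<in> Into U \<Longrightarrow> Comp (Ident U) f = f"
  by (auto simp: Comp_def Ident_def Into_def Arr_iff F_comp_id_left)

lemma Comp_Ident_right: "f \<in> Into U \<Longrightarrow> Comp f (Ident (src f)) = f"
  by (auto simp: Comp_def Ident_def Into_def Arr_iff F_comp_id_right)

lemma Comp_assoc:
  "h \<in> Into U \<Longrightarrow> g \<in> Into (src h) \<Longrightarrow> f \<in> Into (src g) \<Longrightarrow> Comp h (Comp g f) = Comp (Comp h g) f"
  by (auto simp: Comp_def Into_def Arr_iff F_comp_assoc)

lemma src_Comp [simp]: "src (Comp g f) = src f" and src_Ident [simp]: "src (Ident U) = U"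
  by (simp_all add: Comp_def Ident_def)

lemma set_time_Obj: "U \<in> Obj \<Longrightarrow> \<kappa> \<in> names (ctx U) \<Longrightarrow> set_time U \<kappa> n \<in> Obj"
  by (auto simp: Obj_def set_time_def clk_def PiE_def extensional_def)

lemma advance_Into:
  "U \<in> Obj \<Longrightarrow> \<kappa> \<in> names (ctx U) \<Longrightarrow> advance U \<kappa> n \<in> Into (set_time U \<kappa> (time U \<kappa> + n))"
  using set_time_Obj[of U \<kappa> "time U \<kappa> + n"]
  by (auto simp: Into_def Arr_iff advance_def set_time_def F_id_hom rename_id)

lemma presheaf_One: "is_presheaf One"
  by (simp add: is_presheaf_def One_def)

lemma presheaf_Prod: "is_presheaf X \<Longrightarrow> is_presheaf Y \<Longrightarrow> is_presheaf (Product X Y)"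
  by (auto simp: is_presheaf_def Product_def)

lemma presheaf_Clock: "is_presheaf Clock"
  by (auto simp: is_presheaf_def Clock_def Arr_iff Into_def Ident_def Comp_def rename_id rename_comp
      intro: rename_names)

lemma Arr_Into: "f \<in> Arr \<longleftrightarrow> f \<in> Into (trg f)" by (simp add: Into_def)
lemma trg_Into: "f \<in> Into U \<Longrightarrow> trg f = U" by (simp add: Into_def)

lemma presheaf_Omega: "is_presheaf Omega"
proof -
  have "is_sieve (src f) {g \<in> Into (src f). Comp f g \<in> S}" if "f \<in> Into U" "is_sieve U S" for f U S
    using that by (auto simp: is_sieve_def Comp_assoc intro: Comp_Into)
  moreover have "{g \<in> Into U. Comp (Ident U) g \<in> S} = S" if "is_sieve U S" for U S
    using that by (auto simp: is_sieve_def Comp_Ident_left)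
  moreover have "{h \<in> Into (src f). Comp (Comp g f) h \<in> S} =
      {h \<in> Into (src f). Comp f h \<in> {k \<in> Into (src g). Comp g k \<in> S}}"
    if "g \<in> Into U" "f \<in> Into (src g)" for f g U S
    using that by (auto simp: Comp_assoc Comp_Into)
  ultimately show ?thesis
    by (simp add: is_presheaf_def Omega_def Arr_Into)
qed

lemma presheaf_Exp:
  assumes Y: "is_presheaf Y" and Z: "is_presheaf Z" shows "is_presheaf (Exp Y Z)"
proof -
  have rY: "res Y g y \<in> el Y (src g)" if "g \<in> Into V" "y \<in> el Y V" for g V y
    using Y that by (auto simp: is_presheaf_def Into_def)
  show ?thesis
    unfolding is_presheaf_def Arr_Into
  proof (intro conjI ballI, goal_cases)
    case (1 h \<theta>)
    then have h: "h \<in> Into (trg h)" by (simp add: Into_def)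
    have c: "Comp h f \<in> Into (trg h)" if "f \<in> Into (src h)" for f
      by (rule Comp_Into[OF h that])
    have a: "Comp h (Comp f g) = Comp (Comp h f) g" if "f \<in> Into (src h)" "g \<in> Into (src f)" for f g
      by (rule Comp_assoc[OF h that])
    have "\<theta> (Comp h f, y) \<in> el Z (src f)" if "f \<in> Into (src h)" "y \<in> el Y (src f)" for f y
      using 1(2) c[OF that(1)] that by (force simp: Exp_def PiE_iff)
    moreover have "\<theta> (Comp (Comp h f) g, res Y g y) = res Z g (\<theta> (Comp h f, y))"
      if "f \<in> Into (src h)" "y \<in> el Y (src f)" "g \<in> Into (src f)" for f g y
      using 1(2) c[OF that(1)] that by (auto simp: Exp_def)
    ultimately show ?case
      by (auto simp: Exp_def PiE_iff Comp_Into a intro: rY)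
  next
    case (2 U \<theta>)
    show ?case
      by (rule ext, use 2 in \<open>auto simp: Exp_def PiE_iff Comp_Ident_left restrict_def extensional_def\<close>) metis+
  next
    case (3 g f \<theta>)
    have "Comp (Comp g f) a = Comp g (Comp f a)" if "a \<in> Into (src f)" for a
      using Comp_assoc[of g "trg g" f a] 3 that by (simp add: Into_def)
    then show ?case
      by (intro ext) (use 3 in \<open>auto simp: Exp_def restrict_def Comp_assoc Comp_Into\<close>)
  qed
qed

end

theory Submission
  imports Defs
begin

text \<open>If the clock has run out, \<open>\<triangleright>\<close> holds vacuously and any element of the inhabited \<open>Y\<close> is a
  witness.  Otherwise \<open>\<exists>y. \<triangleright>\<phi>(y)\<close> asks for a witness one tick later that lies in the image of the
  restriction map of \<open>Y\<close>, whereas \<open>\<triangleright>(\<exists>y. \<phi>(y))\<close> asks for an arbitrary one; totality makes the two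
  conditions the same.\<close>

lemma set_time_set_time [simp]: "set_time (set_time U \<kappa> m) \<kappa> n = set_time U \<kappa> n"
  by (simp add: set_time_def)

lemma set_time_triv [simp]: "set_time U \<kappa> (time U \<kappa>) = U"
  by (simp add: set_time_def)

lemma ctx_set_time [simp]: "ctx (set_time U \<kappa> n) = ctx U"
  by (simp add: set_time_def)

lemma time_set_time_same [simp]: "time (set_time U \<kappa> n) \<kappa> = n"
  by (simp add: set_time_def)

lemma src_in_Obj: "f \<in> Into U \<Longrightarrow> src f \<in> Obj"
  by (simp add: Into_def Arr_def)

lemma is_total_res_advance_image:
  assumes "is_total X" "U \<in> Obj" "\<kappa> \<in> names (ctx U)" "time U \<kappa> = m + n"
  shows "res X (advance (set_time U \<kappa> m) \<kappa> n) ` el X U = el X (set_time U \<kappa> m)"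
proof -
  let ?V = "set_time U \<kappa> m"
  have "?V \<in> Obj" and "\<kappa> \<in> names (ctx ?V)"
    using assms(2,3) by (simp_all add: set_time_Obj)
  then have "res X (advance ?V \<kappa> n) ` el X (set_time ?V \<kappa> (time ?V \<kappa> + n)) = el X ?V"
    using \<open>is_total X\<close> unfolding is_total_def by blast
  moreover have "set_time ?V \<kappa> (time ?V \<kappa> + n) = U"
    by (simp flip: assms(4))
  ultimately show ?thesis by simp
qed

lemma inhabited_iff: "inhabited X \<longleftrightarrow> (\<forall>U\<in>Obj. el X U \<noteq> {})"
  by (auto simp: inhabited_def valid_def Exists_def Truth_def)

definition valid_in :: "'g presheaf \<Rightarrow> 'g fm \<Rightarrow> bool" where
  "valid_in \<Gamma> \<phi> \<longleftrightarrow> (\<forall>U\<in>Obj. \<forall>\<alpha>\<in>el \<Gamma> U. \<phi> \<Gamma> U \<alpha>)"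

lemma valid_iff_valid_in_One: "valid \<phi> \<longleftrightarrow> valid_in One \<phi>"
  by (simp add: valid_def valid_in_def One_def)

lemma is_presheaf_res_el: "is_presheaf X \<Longrightarrow> f \<in> Into U \<Longrightarrow> x \<in> el X U \<Longrightarrow> res X f x \<in> el X (src f)"
  by (auto simp: is_presheaf_def Into_def)

lemma is_presheaf_res_Ident: "is_presheaf X \<Longrightarrow> U \<in> Obj \<Longrightarrow> x \<in> el X U \<Longrightarrow> res X (Ident U) x = x"
  by (simp add: is_presheaf_def)

lemma valid_in_Forall_iff:
  assumes "is_presheaf \<Gamma>"
  shows "valid_in \<Gamma> (Forall X \<phi>) \<longleftrightarrow> valid_in (Product \<Gamma> X) \<phi>"
proof
  assume forall: "valid_in \<Gamma> (Forall X \<phi>)"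
  have "\<phi> (Product \<Gamma> X) U (\<alpha>, x)" if "U \<in> Obj" "\<alpha> \<in> el \<Gamma> U" "x \<in> el X U" for U \<alpha> x
    using forall that Ident_Into[OF \<open>U \<in> Obj\<close>]
    by (force simp: valid_in_def Forall_def is_presheaf_res_Ident[OF assms])
  then show "valid_in (Product \<Gamma> X) \<phi>"
    by (auto simp: valid_in_def Product_def)
next
  assume "valid_in (Product \<Gamma> X) \<phi>"
  then show "valid_in \<Gamma> (Forall X \<phi>)"
    by (auto simp: valid_in_def Forall_def Product_def src_in_Obj is_presheaf_res_el[OF assms])
qed

lemma valid_in_Imp_iff:
  assumes "is_presheaf \<Gamma>"
  shows "valid_in \<Gamma> (Imp \<phi> \<psi>) \<longleftrightarrow> (\<forall>U\<in>Obj. \<forall>\<alpha>\<in>el \<Gamma> U. \<phi> \<Gamma> U \<alpha> \<longrightarrow> \<psi> \<Gamma> U \<alpha>)"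
proof
  assume imp: "valid_in \<Gamma> (Imp \<phi> \<psi>)"
  have "\<psi> \<Gamma> U \<alpha>" if "U \<in> Obj" "\<alpha> \<in> el \<Gamma> U" "\<phi> \<Gamma> U \<alpha>" for U \<alpha>
    using imp that Ident_Into[OF \<open>U \<in> Obj\<close>]
    by (force simp: valid_in_def Imp_def is_presheaf_res_Ident[OF assms])
  then show "\<forall>U\<in>Obj. \<forall>\<alpha>\<in>el \<Gamma> U. \<phi> \<Gamma> U \<alpha> \<longrightarrow> \<psi> \<Gamma> U \<alpha>" by blast
next
  assume "\<forall>U\<in>Obj. \<forall>\<alpha>\<in>el \<Gamma> U. \<phi> \<Gamma> U \<alpha> \<longrightarrow> \<psi> \<Gamma> U \<alpha>"
  then show "valid_in \<Gamma> (Imp \<phi> \<psi>)"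
    by (simp add: valid_in_def Imp_def src_in_Obj is_presheaf_res_el[OF assms])
qed

definition weaken :: "('g, 'a) tm \<Rightarrow> ('g \<times> 'b, 'a) tm" where
  "weaken t U \<alpha> = t U (fst \<alpha>)"

lemma weaken_v1: "weaken v1 = v2"
  by (simp add: weaken_def v1_def v2_def fun_eq_iff)

lemma Later_time_0: "time U (k U \<alpha>) = 0 \<Longrightarrow> Later k \<phi> \<Gamma> U \<alpha>"
  by (simp add: Later_def)

lemma Later_time_Suc:
  assumes "time U (k U \<alpha>) = Suc n"
  shows "Later k \<phi> \<Gamma> U \<alpha> \<longleftrightarrow>
    \<phi> \<Gamma> (set_time U (k U \<alpha>) n) (res \<Gamma> (advance (set_time U (k U \<alpha>) n) (k U \<alpha>) 1) \<alpha>)"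
  using assms by (simp add: Later_def Let_def)

lemma Exists_Later_iff_time_Suc:
  assumes "is_total Y" "U \<in> Obj" "k U \<alpha> \<in> names (ctx U)" and time: "time U (k U \<alpha>) = Suc n"
  shows "Exists Y (Later (weaken k) \<phi>) \<Gamma> U \<alpha> \<longleftrightarrow> Later k (Exists Y \<phi>) \<Gamma> U \<alpha>"
proof -
  define V where "V = set_time U (k U \<alpha>) n"
  define a where "a = advance V (k U \<alpha>) 1"
  have image: "res Y a ` el Y U = el Y V"
    unfolding a_def V_def using assms by (intro is_total_res_advance_image) simp_all
  have "Exists Y (Later (weaken k) \<phi>) \<Gamma> U \<alpha> \<longleftrightarrow>
      (\<exists>y\<in>el Y U. \<phi> (Product \<Gamma> Y) V (res \<Gamma> a \<alpha>, res Y a y))"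
    using time by (simp add: Exists_def Later_time_Suc weaken_def Product_def V_def a_def)
  also have "\<dots> \<longleftrightarrow> (\<exists>y\<in>el Y V. \<phi> (Product \<Gamma> Y) V (res \<Gamma> a \<alpha>, y))"
    by (simp flip: image)
  also have "\<dots> \<longleftrightarrow> Later k (Exists Y \<phi>) \<Gamma> U \<alpha>"
    using time by (simp add: Exists_def Later_time_Suc V_def a_def)
  finally show ?thesis .
qed

lemma Later_Exists_imp_Exists_Later:
  assumes "is_total Y" "inhabited Y" "U \<in> Obj" "k U \<alpha> \<in> names (ctx U)"
    and later: "Later k (Exists Y \<phi>) \<Gamma> U \<alpha>"
  shows "Exists Y (Later (weaken k) \<phi>) \<Gamma> U \<alpha>"
proof (cases "time U (k U \<alpha>)")
  case 0
  obtain y where "y \<in> el Y U"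
    using assms(2,3) by (auto simp: inhabited_iff)
  moreover have "Later (weaken k) \<phi> (Product \<Gamma> Y) U (\<alpha>, y)"
    using 0 by (simp add: Later_time_0 weaken_def)
  ultimately show ?thesis
    by (auto simp: Exists_def)
next
  case (Suc n)
  then show ?thesis
    using assms by (simp add: Exists_Later_iff_time_Suc)
qed

theorem mainTheorem9:
  fixes Y :: "'a presheaf"
  assumes "is_presheaf Y"
    and "is_total Y"
    and "inhabited Y"
  shows "valid (Forall Clock (Forall (Exp Y Omega)
           (Imp (Later v1 (Exists Y (App v1 v0))) (Exists Y (Later v2 (App v1 v0))))))"
proof -
  let ?\<Delta> = "Product One Clock" and ?\<Gamma> = "Product (Product One Clock) (Exp Y Omega)"
  have \<Delta>: "is_presheaf ?\<Delta>"
    by (intro presheaf_Prod presheaf_One presheaf_Clock)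
  have \<Gamma>: "is_presheaf ?\<Gamma>"
    by (intro presheaf_Prod \<Delta> presheaf_Exp \<open>is_presheaf Y\<close> presheaf_Omega)
  have clock: "v1 U \<alpha> \<in> names (ctx U)" if "\<alpha> \<in> el ?\<Gamma> U" for U \<alpha>
    using that by (auto simp: v1_def Product_def Clock_def)
  have "valid_in ?\<Gamma> (Imp (Later v1 (Exists Y (App v1 v0))) (Exists Y (Later v2 (App v1 v0))))"
    unfolding valid_in_Imp_iff[OF \<Gamma>] weaken_v1[symmetric]
    by (intro ballI impI Later_Exists_imp_Exists_Later \<open>is_total Y\<close> \<open>inhabited Y\<close> clock)
  then show ?thesis
    by (simp only: valid_iff_valid_in_One valid_in_Forall_iff presheaf_One \<Delta>)
qed

end
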